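(* Consider a finite element semidiscretisation of a linear (scalar or system) hyperbolic equation with homogeneous boundary conditions imposed weakly by the SAT approach, written as $$M\,\frac{d}{dt}\underline{U}^h(t)+Q_1\,\underline{U}^h(t)=\Pi\,\underline{U}^h(t),\qquad t>0,\qquad \underline{U}^h(0)=\underline{U}_{in},$$ where $\underline{U}^h(t)$ is the real vector of degrees of freedom, $M$ is the mass matrix, $Q_1$ is the matrix of the spatial operator and $\Pi$ is the boundary matrix. Let $M$ be symmetric and positive definite. If $\Pi$ together with $Q_1$ is chosen such that the matrix $$(\Pi-Q_1)+(\Pi-Q_1)^T$$ is negative semi-definite, then the scheme is energy stable.
   Context: SAT (simultaneous approximation term) approach: the boundary conditions are not imposed strongly but are enforced through a penalty term on the right-hand side of the semidiscrete scheme. For homogeneous boundary conditions this term is a linear boundary operator, represented by a real matrix $\Pi$ (usually sparse) acting on the vector of degrees of freedom. The real square matrix $Q_1$ represents the discretized spatial operator, and $Q_1+Q_1^T$ has contributions only on the boundaries (SBP property). The matrices $M$, $Q_1$, $\Pi$ do not depend on time. Norm: $\|\underline{U}\|_M^2=\underline{U}^TM\,\underline{U}$. Energy stable (homogeneous boundary data): there is a function $K(t)$, bounded for any finite $t$ and independent of the initial data and of the mesh (the same $K$ serves for all initial data and all meshes, i.e. all discretization matrices satisfying the hypotheses), such that every solution of the scheme satisfies $\|\underline{U}^h(t)\|_M^2\le K(t)\,\|\underline{U}_{in}\|_M^2$ for all $t>0$. *)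

theory Defs
  imports Complex_Main "Jordan_Normal_Form.Matrix"
begin

text \<open>
  The number of degrees of freedom changes with the mesh, and energy stability asks for one bound
  for all meshes.  The dimension therefore has to be quantified inside the definition, which is why
  carrier-based matrices are used and not matrices with a type as index set.
\<close>

record sat_semidiscretisation =
  dofs :: nat
  mass :: "real mat"      \<comment> \<open>\<open>M\<close>\<close>
  spatial :: "real mat"   \<comment> \<open>\<open>Q\<^sub>1\<close>\<close>
  boundary :: "real mat"  \<comment> \<open>\<open>\<Pi>\<close>\<close>

definition well_formed :: "sat_semidiscretisation \<Rightarrow> bool" where
  "well_formed S \<longleftrightarrow>
     mass S \<in> carrier_mat (dofs S) (dofs S) \<and>
     spatial S \<in> carrier_mat (dofs S) (dofs S) \<and>
     boundary S \<in> carrier_mat (dofs S) (dofs S)"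

definition symmetric_matrix :: "real mat \<Rightarrow> bool" where
  "symmetric_matrix A \<longleftrightarrow> square_mat A \<and> A\<^sup>T = A"

definition positive_definite :: "real mat \<Rightarrow> bool" where
  "positive_definite A \<longleftrightarrow>
     square_mat A \<and>
     (\<forall>v \<in> carrier_vec (dim_row A). v \<noteq> 0\<^sub>v (dim_row A) \<longrightarrow> 0 < v \<bullet> (A *\<^sub>v v))"

definition negative_semidefinite :: "real mat \<Rightarrow> bool" where
  "negative_semidefinite A \<longleftrightarrow>
     square_mat A \<and> (\<forall>v \<in> carrier_vec (dim_row A). v \<bullet> (A *\<^sub>v v) \<le> 0)"

definition norm_sq :: "real mat \<Rightarrow> real vec \<Rightarrow> real" where
  "norm_sq M u = u \<bullet> (M *\<^sub>v u)"

text \<open>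
  The type of vectors of arbitrary dimension carries no topology, so continuity and differentiation
  of a vector-valued curve are componentwise.
\<close>

definition continuous_curve_on :: "nat \<Rightarrow> real set \<Rightarrow> (real \<Rightarrow> real vec) \<Rightarrow> bool" where
  "continuous_curve_on n T u \<longleftrightarrow> (\<forall>i<n. continuous_on T (\<lambda>t. u t $ i))"

definition has_curve_derivative ::
    "nat \<Rightarrow> (real \<Rightarrow> real vec) \<Rightarrow> real vec \<Rightarrow> real \<Rightarrow> bool" where
  "has_curve_derivative n u u' t \<longleftrightarrow>
     u' \<in> carrier_vec n \<and> (\<forall>i<n. ((\<lambda>s. u s $ i) has_real_derivative u' $ i) (at t))"

text \<open>
  Continuity on the closed half line ties the equation, which is only posed for \<open>t > 0\<close>, to
  the initial value.  No differentiability is asked for at \<open>0\<close>.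
\<close>

definition is_solution ::
    "sat_semidiscretisation \<Rightarrow> real vec \<Rightarrow> (real \<Rightarrow> real vec) \<Rightarrow> bool" where
  "is_solution S u\<^sub>i\<^sub>n u \<longleftrightarrow>
     (\<forall>t\<ge>0. u t \<in> carrier_vec (dofs S)) \<and>
     continuous_curve_on (dofs S) {0..} u \<and>
     u 0 = u\<^sub>i\<^sub>n \<and>
     (\<forall>t>0. \<exists>u'. has_curve_derivative (dofs S) u u' t \<and>
        mass S *\<^sub>v u' + spatial S *\<^sub>v u t = boundary S *\<^sub>v u t)"

text \<open>
  Energy stability is a property of a whole class of semidiscretisations (all meshes): \<open>K\<close> is
  chosen before the member of the class and before the initial data.  Being bounded for finite time
  means being bounded on every interval \<open>[0, T]\<close>.
\<close>

definition energy_stable :: "sat_semidiscretisation set \<Rightarrow> bool" where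
  "energy_stable \<S> \<longleftrightarrow>
     (\<exists>K :: real \<Rightarrow> real.
        (\<forall>T>0. \<exists>C. \<forall>t\<in>{0..T}. \<bar>K t\<bar> \<le> C) \<and>
        (\<forall>S\<in>\<S>. \<forall>u\<^sub>i\<^sub>n \<in> carrier_vec (dofs S). \<forall>u. is_solution S u\<^sub>i\<^sub>n u \<longrightarrow>
           (\<forall>t>0. norm_sq (mass S) (u t) \<le> K t * norm_sq (mass S) u\<^sub>i\<^sub>n)))"

end

(* Energy method with K = 1: along a solution, symmetry of M gives
   d/dt (U^T M U) = 2 U^T M U' = 2 U^T (Pi - Q1) U = U^T ((Pi - Q1) + (Pi - Q1)^T) U <= 0
   for t > 0, and continuity at 0 carries the monotonicity down to the initial value. *)
theory Submission
  imports Defs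
begin

text \<open>Vectors of arbitrary dimension have only componentwise calculus here. Expanding the form
  into a finite double sum of products of components reduces continuity and differentiation of the
  energy to facts about real functions.\<close>

lemma bilinear_form_eq_sum:
  fixes A :: "'a :: comm_semiring_0 mat"
  assumes "A \<in> carrier_mat n n" "x \<in> carrier_vec n" "y \<in> carrier_vec n"
  shows "x \<bullet> (A *\<^sub>v y) = (\<Sum>i<n. \<Sum>j<n. A $$ (i, j) * (x $ i * y $ j))"
  using assms
  by (auto simp: scalar_prod_def lessThan_atLeast0 sum_distrib_left mult.left_commute intro!: sum.cong)

lemma scalar_prod_mult_transpose:
  fixes A :: "'a :: comm_semiring_0 mat"
  assumes "A \<in> carrier_mat n n" "x \<in> carrier_vec n" "y \<in> carrier_vec n"
  shows "x \<bullet> (A\<^sup>T *\<^sub>v y) = y \<bullet> (A *\<^sub>v x)"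
  using assms transpose_vec_mult_scalar[of A n n x y]
  by (metis comm_scalar_prod mult_mat_vec_carrier transpose_carrier_mat)

text \<open>A quadratic form does not change when its matrix is transposed. This connects the
  hypothesis on the symmetrised matrix with the unsymmetrised form that the energy derivative
  produces.\<close>

lemma quadratic_form_add_transpose:
  fixes A :: "'a :: comm_semiring_1 mat"
  assumes "A \<in> carrier_mat n n" "x \<in> carrier_vec n"
  shows "x \<bullet> ((A + A\<^sup>T) *\<^sub>v x) = 2 * (x \<bullet> (A *\<^sub>v x))"
proof -
  have "x \<bullet> ((A + A\<^sup>T) *\<^sub>v x) = x \<bullet> (A *\<^sub>v x) + x \<bullet> (A\<^sup>T *\<^sub>v x)"
    using assms by (simp add: add_mult_distrib_mat_vec[of _ n n] scalar_prod_add_distrib[of _ n])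
  then show ?thesis
    using scalar_prod_mult_transpose[of A n x x] assms by (simp add: mult_2)
qed

lemma continuous_on_norm_sq:
  assumes "M \<in> carrier_mat n n" "\<And>t. t \<in> T \<Longrightarrow> u t \<in> carrier_vec n"
    and "continuous_curve_on n T u"
  shows "continuous_on T (\<lambda>t. norm_sq M (u t))"
proof -
  have "continuous_on T (\<lambda>t. \<Sum>i<n. \<Sum>j<n. M $$ (i, j) * (u t $ i * u t $ j))"
    using assms(3) unfolding continuous_curve_on_def by (intro continuous_intros) auto
  \<comment> \<open>The expansion is valid only where \<open>u t\<close> has length
    \<open>n\<close>, so the two functions are identified on \<open>T\<close> alone.\<close>
  then show ?thesis
    unfolding norm_sq_def
    by (rule continuous_on_cong[THEN iffD1, rotated -1])
       (simp_all add: bilinear_form_eq_sum[OF assms(1)] assms(2))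
qed

text \<open>Outside \<open>T\<close> the values of \<open>u\<close> may have any length, and there
  the double sum need not equal the energy. Since a derivative is local, agreement on an open set
  around \<open>t\<close> is enough.\<close>

lemma has_real_derivative_norm_sq:
  assumes M: "M \<in> carrier_mat n n" "M\<^sup>T = M"
    and T: "open T" "t \<in> T" "\<And>s. s \<in> T \<Longrightarrow> u s \<in> carrier_vec n"
    and u': "has_curve_derivative n u u' t"
  shows "((\<lambda>s. norm_sq M (u s)) has_real_derivative 2 * (u t \<bullet> (M *\<^sub>v u'))) (at t)"
proof -
  have carr: "u' \<in> carrier_vec n" "u t \<in> carrier_vec n"
    using u' T by (auto simp: has_curve_derivative_def)
  have "((\<lambda>s. \<Sum>i<n. \<Sum>j<n. M $$ (i, j) * (u s $ i * u s $ j)) has_real_derivative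
      (\<Sum>i<n. \<Sum>j<n. M $$ (i, j) * (u' $ i * u t $ j + u' $ j * u t $ i))) (at t)"
    using u' unfolding has_curve_derivative_def
    by (intro DERIV_sum DERIV_cmult DERIV_mult) auto
  also have "(\<Sum>i<n. \<Sum>j<n. M $$ (i, j) * (u' $ i * u t $ j + u' $ j * u t $ i))
      = u' \<bullet> (M *\<^sub>v u t) + u t \<bullet> (M *\<^sub>v u')"
    using carr M(1) by (simp add: bilinear_form_eq_sum sum.distrib algebra_simps)
  \<comment> \<open>The product rule leaves one term for each factor; symmetry of \<open>M\<close>
    makes the two equal.\<close>
  also have "\<dots> = 2 * (u t \<bullet> (M *\<^sub>v u'))"
    using scalar_prod_mult_transpose[OF M(1) carr] M(2) by simp
  finally show ?thesis
    unfolding norm_sq_def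
    by (rule has_field_derivative_transform_within_open[OF _ T(1,2)])
       (simp add: bilinear_form_eq_sum[OF M(1)] T(3))
qed

lemma norm_sq_solution_le_initial:
  assumes wf: "well_formed S" and sym: "symmetric_matrix (mass S)"
    and nsd: "negative_semidefinite
      ((boundary S - spatial S) + (boundary S - spatial S)\<^sup>T)"
    and sol: "is_solution S u\<^sub>i\<^sub>n u" and t: "0 < t"
  shows "norm_sq (mass S) (u t) \<le> norm_sq (mass S) u\<^sub>i\<^sub>n"
proof -
  define n where "n = dofs S"
  define B where "B = boundary S - spatial S"
  have carr: "mass S \<in> carrier_mat n n" "spatial S \<in> carrier_mat n n"
    "boundary S \<in> carrier_mat n n" "B \<in> carrier_mat n n"
    using wf by (auto simp: well_formed_def n_def B_def)
  have u: "u s \<in> carrier_vec n" if "0 \<le> s" for s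
    using sol that by (auto simp: is_solution_def n_def)
  have deriv: "\<exists>y. ((\<lambda>s. norm_sq (mass S) (u s)) has_real_derivative y) (at s) \<and> y \<le> 0"
    if s: "0 < s" for s
  proof -
    obtain u' where u': "has_curve_derivative n u u' s"
      and eq: "mass S *\<^sub>v u' + spatial S *\<^sub>v u s = boundary S *\<^sub>v u s"
      using sol s by (auto simp: is_solution_def n_def)
    have us: "u s \<in> carrier_vec n" using u s by simp
    have u'_carr: "u' \<in> carrier_vec n" using u' by (simp add: has_curve_derivative_def)
    \<comment> \<open>The derivative enters the energy balance only through
      \<open>mass S *\<^sub>v u'\<close>, so the equation is solved for this product and the mass
      matrix is never inverted.\<close>
    have "mass S *\<^sub>v u' = (mass S *\<^sub>v u' + spatial S *\<^sub>v u s) - spatial S *\<^sub>v u s"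
      using carr us u'_carr by (intro eq_vecI) auto
    also have "\<dots> = B *\<^sub>v u s"
      unfolding eq B_def using carr us by (simp add: minus_mult_distrib_mat_vec)
    finally have "2 * (u s \<bullet> (mass S *\<^sub>v u')) = u s \<bullet> ((B + B\<^sup>T) *\<^sub>v u s)"
      using quadratic_form_add_transpose[OF carr(4) us] by simp
    also have "\<dots> \<le> 0"
      using nsd us carr(4) by (auto simp: negative_semidefinite_def B_def[symmetric])
    finally have "2 * (u s \<bullet> (mass S *\<^sub>v u')) \<le> 0" .
    moreover have "((\<lambda>s. norm_sq (mass S) (u s)) has_real_derivative
        2 * (u s \<bullet> (mass S *\<^sub>v u'))) (at s)"
      \<comment> \<open>A solution consists of vectors of the right length for nonnegative times
        only; the open half line is a neighbourhood of \<open>s\<close> inside that range.\<close>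
      using carr(1) sym u' s u
      by (intro has_real_derivative_norm_sq[where T = "{0<..}"])
         (auto simp: symmetric_matrix_def)
    ultimately show ?thesis by blast
  qed
  have "continuous_on {0..} (\<lambda>s. norm_sq (mass S) (u s))"
    using sol carr(1) u
    by (intro continuous_on_norm_sq[where n = n]) (auto simp: is_solution_def n_def)
  then have "continuous_on {0..t} (\<lambda>s. norm_sq (mass S) (u s))"
    by (rule continuous_on_subset) auto
  \<comment> \<open>This form of the mean value argument needs derivatives only strictly between 0
    and \<open>t\<close>, and continuity at the endpoints.\<close>
  then have "norm_sq (mass S) (u t) \<le> norm_sq (mass S) (u 0)"
    using t deriv by (intro DERIV_nonpos_imp_decreasing_open[of 0 t]) auto
  then show ?thesis
    using sol by (simp add: is_solution_def)
qed

theorem theorem3p6: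
  shows "energy_stable
    {S. well_formed S \<and>
        symmetric_matrix (mass S) \<and> positive_definite (mass S) \<and>
        negative_semidefinite
          ((boundary S - spatial S) + (boundary S - spatial S)\<^sup>T)}"
  unfolding energy_stable_def
  \<comment> \<open>The bound for a single semidiscretisation contains no constant depending on its
    dimension, matrices or data, so one \<open>K\<close> serves the whole class.\<close>
  by (rule exI[of _ "\<lambda>_. 1"]) (auto intro: norm_sq_solution_le_initial)

end
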